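(* Let $d\ge1$ and $d+1\le r\le 2d$ be integers. There exist constants $C>0$ and $n_0$ (depending only on $d$ and $r$) such that for all integers $n\ge n_0$, $$\overleftarrow{m}(\mathbb{T}_n^d,r)\ \ge\ 2\Big(1-\frac{d}{r}\Big)n^d-Cn^{d-1}.$$
   Context: The $d$-dimensional torus $\mathbb{T}_n^d$ is the graph with vertex set $[n]^d=\{1,\dots,n\}^d$, where two vertices are adjacent iff they differ in exactly one coordinate $j$ and in that coordinate $x_j-x'_j\equiv\pm1\pmod n$. A configuration assigns each vertex a state active (1) or inactive (0); its size is the number of active vertices. Reversible $r$-bootstrap percolation: in each round, simultaneously, every vertex becomes active if it has at least $r$ active neighbors and inactive otherwise. A dynamo is an initial configuration such that from some time on all vertices are active forever. $\overleftarrow{m}(G,r)$ denotes the minimum size of a dynamo under reversible $r$-bootstrap percolation on $G$. *)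

theory Defs
  imports Complex_Main "HOL-Library.FuncSet" "HOL-Number_Theory.Cong"
begin

text \<open>A graph is given by its vertex set \<open>V\<close> and adjacency relation \<open>E\<close>;
  a configuration is represented by its set of active vertices.\<close>

definition rev_step :: "'a set \<Rightarrow> ('a \<Rightarrow> 'a \<Rightarrow> bool) \<Rightarrow> nat \<Rightarrow> 'a set \<Rightarrow> 'a set" where
  "rev_step V E r A = {v \<in> V. r \<le> card {u \<in> V. E v u \<and> u \<in> A}}"

definition rev_dynamo :: "'a set \<Rightarrow> ('a \<Rightarrow> 'a \<Rightarrow> bool) \<Rightarrow> nat \<Rightarrow> 'a set \<Rightarrow> bool" where
  "rev_dynamo V E r A \<longleftrightarrow> A \<subseteq> V \<and> (\<exists>T. \<forall>t\<ge>T. (rev_step V E r ^^ t) A = V)"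

text \<open>On the natural numbers \<open>Inf\<close> of a nonempty set is its minimum, while \<open>Inf {} = 0\<close>.
  Thus the following is the minimum size of a dynamo whenever one exists; on the torus with
  \<open>n \<ge> 3\<close> and \<open>r \<le> 2 * d\<close> the all-active configuration is one.\<close>

definition min_rev_dynamo :: "'a set \<Rightarrow> ('a \<Rightarrow> 'a \<Rightarrow> bool) \<Rightarrow> nat \<Rightarrow> nat" where
  "min_rev_dynamo V E r = Inf {card A | A. rev_dynamo V E r A}"

definition torus_verts :: "nat \<Rightarrow> nat \<Rightarrow> (nat \<Rightarrow> nat) set" where
  "torus_verts d n = {1..d} \<rightarrow>\<^sub>E {1..n}"

definition torus_adj :: "nat \<Rightarrow> nat \<Rightarrow> (nat \<Rightarrow> nat) \<Rightarrow> (nat \<Rightarrow> nat) \<Rightarrow> bool" where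
  "torus_adj d n x y \<longleftrightarrow>
     (\<exists>j. {i \<in> {1..d}. x i \<noteq> y i} = {j} \<and>
        ([int (x j) - int (y j) = 1] (mod int n) \<or> [int (x j) - int (y j) = - 1] (mod int n)))"

end

theory Submission
  imports Defs
begin

text \<open>The Goles--Olivos energy \<open>r|A| + r|B| - e(A, B)\<close> of two consecutive configurations is
  symmetric in \<open>A\<close> and \<open>B\<close>, and for fixed \<open>A\<close> it is minimised over \<open>B\<close> by the successor of \<open>A\<close>.
  Hence it never increases along the dynamics. Taking \<open>B\<close> empty, its initial value is at most
  \<open>r|A|\<close>, whereas once everything is active it is \<open>(2r - 2d)|V|\<close> on a \<open>2d\<close>-regular graph.\<close>

section \<open>Energy of two consecutive configurations\<close>

definition active_degree :: "'a set \<Rightarrow> ('a \<Rightarrow> 'a \<Rightarrow> bool) \<Rightarrow> 'a set \<Rightarrow> 'a \<Rightarrow> nat" where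
  "active_degree V E A v = card {u \<in> V. E v u \<and> u \<in> A}"

text \<open>Written as a sum over \<open>B\<close> so that minimising over \<open>B\<close> becomes
  a separate choice at each vertex; the price is that symmetry in \<open>A\<close> and
  \<open>B\<close> has to be proved.\<close>

definition energy :: "'a set \<Rightarrow> ('a \<Rightarrow> 'a \<Rightarrow> bool) \<Rightarrow> nat \<Rightarrow> 'a set \<Rightarrow> 'a set \<Rightarrow> int" where
  "energy V E r A B = int r * int (card A) + (\<Sum>v\<in>B. int r - int (active_degree V E A v))"

lemma rev_step_subset: "rev_step V E r A \<subseteq> V"
  by (auto simp: rev_step_def)

lemma rev_step_iter_subset:
  assumes "A \<subseteq> V"
  shows "(rev_step V E r ^^ t) A \<subseteq> V"
  using assms by (cases t) (simp_all add: rev_step_subset)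

lemma energy_empty: "energy V E r A {} = int r * int (card A)"
  by (simp add: energy_def)

text \<open>Double counting: the degree terms on either side count the ordered pairs of adjacent
  vertices with one end in \<open>A\<close> and the other in \<open>B\<close>.\<close>

lemma energy_commute:
  assumes "finite V" "\<And>u v. E u v \<Longrightarrow> E v u" "A \<subseteq> V" "B \<subseteq> V"
  shows "energy V E r A B = energy V E r B A"
proof -
  have fin: "finite A" "finite B"
    using assms finite_subset by blast+
  have deg: "int (active_degree V E X v) = (\<Sum>u\<in>X. if E v u then 1 else 0)"
    if "X \<subseteq> V" "finite X" for X v
  proof -
    have "{u \<in> V. E v u \<and> u \<in> X} = {u \<in> X. E v u}"
      using that by auto
    then show ?thesis
      using that by (simp add: active_degree_def sum.If_cases Int_def)
  qed
  have "(\<Sum>v\<in>B. int (active_degree V E A v)) = (\<Sum>v\<in>B. \<Sum>u\<in>A. if E v u then 1 else 0)"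
    using deg assms fin by simp
  also have "\<dots> = (\<Sum>u\<in>A. \<Sum>v\<in>B. if E v u then 1 else 0)"
    by (rule sum.swap)
  also have "\<dots> = (\<Sum>u\<in>A. \<Sum>v\<in>B. if E u v then 1 else 0)"
    using assms(2) by (intro sum.cong) auto
  also have "\<dots> = (\<Sum>u\<in>A. int (active_degree V E B u))"
    using deg assms fin by simp
  finally show ?thesis
    by (simp add: energy_def sum_subtractf algebra_simps)
qed

text \<open>A vertex put into the second argument contributes r minus its active degree, and the
  successor of \<open>A\<close> collects exactly the vertices where this is at most 0. Passing from
  \<open>?S\<close> to \<open>?S \<inter> B\<close> drops nonpositive terms, and passing on to
  \<open>B\<close> adds nonnegative ones.\<close>

lemma energy_rev_step_le:
  assumes "finite V" "B \<subseteq> V"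
  shows "energy V E r A (rev_step V E r A) \<le> energy V E r A B"
proof -
  let ?f = "\<lambda>v. int r - int (active_degree V E A v)"
  let ?S = "rev_step V E r A"
  have fin: "finite B" "finite ?S"
    using assms rev_step_subset[of V E r A] by (auto intro: finite_subset)
  have in_step: "v \<in> ?S \<longleftrightarrow> ?f v \<le> 0" if "v \<in> V" for v
    using that by (simp add: rev_step_def active_degree_def)
  have "sum ?f ?S \<le> sum ?f (?S \<inter> B)"
  proof -
    have "?f v \<le> 0" if "v \<in> ?S - B" for v
      using that in_step rev_step_subset[of V E r A] by blast
    then have "sum ?f (?S - B) \<le> 0"
      by (rule sum_nonpos)
    then show ?thesis
      using sum.Int_Diff[OF fin(2), of ?f B] by linarith
  qed
  also have "\<dots> \<le> sum ?f B"
  proof (rule sum_mono2[OF fin(1) Int_lower2])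
    fix v assume "v \<in> B - ?S \<inter> B"
    then show "0 \<le> ?f v"
      using assms(2) in_step[of v] by auto
  qed
  finally show ?thesis
    by (simp add: energy_def)
qed

lemma energy_rev_step_iter_le:
  assumes "finite V" "\<And>u v. E u v \<Longrightarrow> E v u" "A \<subseteq> V"
  shows "energy V E r ((rev_step V E r ^^ t) A) ((rev_step V E r ^^ Suc t) A)
           \<le> int r * int (card A)"
proof (induction t)
  case 0
  show ?case
    using energy_rev_step_le[OF assms(1) empty_subsetI, of E r A] by (simp add: energy_empty)
next
  case (Suc t)
  let ?A = "\<lambda>t. (rev_step V E r ^^ t) A"
  have sub: "?A s \<subseteq> V" for s
    using rev_step_iter_subset[OF assms(3)] .
  \<comment> \<open>The competitor to the successor of \<open>?A (Suc t)\<close> is its predecessor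
    \<open>?A t\<close>; symmetry then turns this into the energy one round earlier.\<close>
  have "energy V E r (?A (Suc t)) (?A (Suc (Suc t))) \<le> energy V E r (?A (Suc t)) (?A t)"
    using energy_rev_step_le[OF assms(1) sub] by (simp only: funpow.simps comp_apply)
  also have "\<dots> = energy V E r (?A t) (?A (Suc t))"
    using assms(1,2) by (intro energy_commute sub)
  finally show ?case
    using Suc by simp
qed

lemma rev_dynamo_card_ge:
  assumes "finite V" "\<And>u v. E u v \<Longrightarrow> E v u"
    and deg: "\<And>v. v \<in> V \<Longrightarrow> card {u \<in> V. E v u} \<le> k"
    and "rev_dynamo V E r A"
  shows "(2 * int r - int k) * int (card V) \<le> int r * int (card A)"
proof -
  obtain T where "A \<subseteq> V" and T: "\<forall>t\<ge>T. (rev_step V E r ^^ t) A = V"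
    using assms(4) by (auto simp: rev_dynamo_def)
  have "(\<Sum>v\<in>V. int r - int k) \<le> (\<Sum>v\<in>V. int r - int (active_degree V E V v))"
  proof (rule sum_mono)
    fix v assume "v \<in> V"
    moreover have "{u \<in> V. E v u \<and> u \<in> V} = {u \<in> V. E v u}"
      by auto
    ultimately show "int r - int k \<le> int r - int (active_degree V E V v)"
      using deg by (simp add: active_degree_def)
  qed
  then have "(2 * int r - int k) * int (card V) \<le> energy V E r V V"
    by (simp add: energy_def algebra_simps)
  also have "\<dots> \<le> int r * int (card A)"
  proof -
    \<comment> \<open>The energy involves two rounds, so both arguments have to be identified with
      \<open>V\<close>.\<close>
    have "(rev_step V E r ^^ T) A = V" "(rev_step V E r ^^ Suc T) A = V"
      using T le_SucI by blast+
    then show ?thesis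
      using energy_rev_step_iter_le[of V E A r T] assms(1,2) \<open>A \<subseteq> V\<close> by metis
  qed
  finally show ?thesis .
qed

section \<open>Existence of a smallest dynamo\<close>

lemma rev_dynamo_all_active:
  assumes "\<And>v. v \<in> V \<Longrightarrow> r \<le> card {u \<in> V. E v u}"
  shows "rev_dynamo V E r V"
proof -
  have eq: "{u \<in> V. E v u \<and> u \<in> V} = {u \<in> V. E v u}" for v
    by auto
  have "rev_step V E r V = V"
    using assms by (auto simp: rev_step_def eq)
  then have "(rev_step V E r ^^ t) V = V" for t
    by (induction t) auto
  then show ?thesis
    by (simp add: rev_dynamo_def)
qed

text \<open>Some dynamo must be exhibited first: \<open>Inf {} = 0\<close> would be no size of a
  dynamo, and no lower bound could be transferred to it.\<close>

lemma min_rev_dynamo_attained: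
  assumes "rev_dynamo V E r B"
  obtains A where "rev_dynamo V E r A" "min_rev_dynamo V E r = card A"
proof -
  have "min_rev_dynamo V E r \<in> {card A | A. rev_dynamo V E r A}"
    unfolding min_rev_dynamo_def using assms by (intro Inf_nat_def1) auto
  then show ?thesis
    using that by auto
qed

section \<open>Neighbourhoods in the torus\<close>

definition cyc_shift :: "nat \<Rightarrow> bool \<Rightarrow> nat \<Rightarrow> nat" where
  "cyc_shift n up a =
     (if up then (if a = n then 1 else a + 1) else (if a = 1 then n else a - 1))"

lemma cyc_shift_range:
  assumes "a \<in> {1..n}"
  shows "cyc_shift n up a \<in> {1..n}"
  using assms by (auto simp: cyc_shift_def)

lemma cyc_shift_neq:
  assumes "3 \<le> n" "a \<in> {1..n}"
  shows "cyc_shift n up a \<noteq> a"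
  using assms by (auto simp: cyc_shift_def)

text \<open>This is where n = 2 fails: there both directions lead to the same residue.\<close>

lemma cyc_shift_inj:
  assumes "3 \<le> n" "a \<in> {1..n}" "cyc_shift n up a = cyc_shift n up' a"
  shows "up = up'"
  using assms by (auto simp: cyc_shift_def split: if_splits)

lemma small_multiple:
  fixes k n :: int
  assumes "\<bar>n * k\<bar> < 2 * n"
  shows "k \<in> {-1, 0, 1}"
proof -
  have "n > 0" using assms by linarith
  then have "\<bar>k\<bar> < 2"
    using assms by (simp add: abs_mult mult.commute[of n])
  then show ?thesis by auto
qed

lemma cong_pm_one_iff_cyc_shift:
  assumes "3 \<le> n" "a \<in> {1..n}" "b \<in> {1..n}"
  shows "[int a - int b = 1] (mod int n) \<or> [int a - int b = - 1] (mod int n)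
           \<longleftrightarrow> (\<exists>up. b = cyc_shift n up a)"
proof
  assume "[int a - int b = 1] (mod int n) \<or> [int a - int b = - 1] (mod int n)"
  then obtain e k :: int where e: "e = 1 \<or> e = -1" and k: "int a - int b - e = int n * k"
    unfolding cong_iff_dvd_diff dvd_def by metis
  \<comment> \<open>Representatives in 1..n differ by at most n - 1, and e adds at most 1. The
    multiples n and -n that remain are the wrap-arounds.\<close>
  have "\<bar>int n * k\<bar> < 2 * int n"
    using e assms by (auto simp flip: k)
  then have "k \<in> {-1, 0, 1}"
    by (rule small_multiple)
  then have "int a - int b - e \<in> {- int n, 0, int n}"
    using k by auto
  \<comment> \<open>The congruence bounds a - b, so e = -1 means that b follows a: the upward
    direction.\<close>
  then have "b = cyc_shift n (e = -1) a"
    using e assms by (auto simp: cyc_shift_def)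
  then show "\<exists>up. b = cyc_shift n up a" ..
next
  assume "\<exists>up. b = cyc_shift n up a"
  then show "[int a - int b = 1] (mod int n) \<or> [int a - int b = - 1] (mod int n)"
    using assms by (auto simp: cyc_shift_def cong_iff_dvd_diff of_nat_diff split: if_splits)
qed

lemma torus_adj_sym:
  assumes "torus_adj d n x y"
  shows "torus_adj d n y x"
proof -
  obtain j where j: "{i \<in> {1..d}. x i \<noteq> y i} = {j}"
    and c: "[int (x j) - int (y j) = 1] (mod int n) \<or> [int (x j) - int (y j) = - 1] (mod int n)"
    using assms unfolding torus_adj_def by blast
  have "{i \<in> {1..d}. y i \<noteq> x i} = {j}"
    unfolding j[symmetric] by (rule Collect_cong) metis
  moreover have "[int (y j) - int (x j) = 1] (mod int n) \<or> [int (y j) - int (x j) = - 1] (mod int n)"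
    using c cong_minus_minus_iff[of "int (x j) - int (y j)"]
    by (metis add.inverse_inverse minus_diff_eq)
  ultimately show ?thesis
    unfolding torus_adj_def by blast
qed

text \<open>Indexing neighbours by a coordinate and a boolean direction reduces the degree count to
  the size of a product.\<close>

lemma torus_neighbours_eq:
  assumes "3 \<le> n" "x \<in> torus_verts d n"
  shows "{y \<in> torus_verts d n. torus_adj d n x y} =
    (\<lambda>(j, up). x(j := cyc_shift n up (x j))) ` ({1..d} \<times> UNIV)"
proof (intro set_eqI iffI)
  fix y assume y: "y \<in> {y \<in> torus_verts d n. torus_adj d n x y}"
  then obtain j where j: "{i \<in> {1..d}. x i \<noteq> y i} = {j}"
    and c: "[int (x j) - int (y j) = 1] (mod int n) \<or> [int (x j) - int (y j) = - 1] (mod int n)"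
    unfolding torus_adj_def by blast
  have differ: "i \<in> {1..d} \<and> x i \<noteq> y i \<longleftrightarrow> i = j" for i
    using j unfolding set_eq_iff mem_Collect_eq singleton_iff by (rule spec)
  have jd: "j \<in> {1..d}"
    using differ[of j] by blast
  have "x j \<in> {1..n}" "y j \<in> {1..n}"
    using assms(2) y jd unfolding torus_verts_def by blast+
  then obtain up where up: "y j = cyc_shift n up (x j)"
    using c cong_pm_one_iff_cyc_shift[OF assms(1)] by blast
  have "y i = (x(j := y j)) i" for i
  proof (cases "i \<in> {1..d}")
    case True
    then show ?thesis using differ[of i] by (cases "i = j") simp_all
  next
    \<comment> \<open>Outside the coordinate range both functions are \<open>undefined\<close>, by
      extensionality of \<open>torus_verts\<close>.\<close>
    case False
    then show ?thesis
      using assms(2) y jd PiE_arb[of x "{1..d}"] PiE_arb[of y "{1..d}"]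
      unfolding torus_verts_def by (metis (lifting) fun_upd_other mem_Collect_eq)
  qed
  then have "y = x(j := cyc_shift n up (x j))"
    using up by auto
  then show "y \<in> (\<lambda>(j, up). x(j := cyc_shift n up (x j))) ` ({1..d} \<times> UNIV)"
    using jd by auto
next
  fix y assume "y \<in> (\<lambda>(j, up). x(j := cyc_shift n up (x j))) ` ({1..d} \<times> UNIV)"
  then obtain j up where jd: "j \<in> {1..d}" and y: "y = x(j := cyc_shift n up (x j))"
    by auto
  have xj: "x j \<in> {1..n}"
    using assms(2) jd unfolding torus_verts_def by blast
  have sj: "y j \<in> {1..n}" "y j \<noteq> x j"
    using y cyc_shift_range[OF xj] cyc_shift_neq[OF assms(1) xj] by auto
  have "x(j := y j) \<in> insert j {1..d} \<rightarrow>\<^sub>E {1..n}"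
    using assms(2) sj(1) unfolding torus_verts_def
    by (intro PiE_fun_upd)
  then have "y \<in> torus_verts d n"
    using jd y by (simp add: torus_verts_def insert_absorb)
  moreover have "{i \<in> {1..d}. x i \<noteq> y i} = {j}"
    using jd y sj by auto
  moreover have "[int (x j) - int (y j) = 1] (mod int n) \<or> [int (x j) - int (y j) = - 1] (mod int n)"
    using cong_pm_one_iff_cyc_shift[OF assms(1) xj sj(1)] y by auto
  ultimately show "y \<in> {y \<in> torus_verts d n. torus_adj d n x y}"
    unfolding torus_adj_def by blast
qed

lemma torus_degree:
  assumes "3 \<le> n" "x \<in> torus_verts d n"
  shows "card {y \<in> torus_verts d n. torus_adj d n x y} = 2 * d"
proof -
  have range: "x j \<in> {1..n}" if "j \<in> {1..d}" for j
    using assms(2) that unfolding torus_verts_def by blast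
  have "inj_on (\<lambda>(j, up). x(j := cyc_shift n up (x j))) ({1..d} \<times> UNIV)"
  proof (rule inj_onI, clarify)
    fix j k up up'
    assume jk: "j \<in> {1..d}" "k \<in> {1..d}"
      and eq: "x(j := cyc_shift n up (x j)) = x(k := cyc_shift n up' (x k))"
    have "j = k"
      \<comment> \<open>At coordinate j the left side has moved away from \<open>x j\<close>, while
        for k distinct from j the right side has not.\<close>
      using fun_cong[OF eq, of j] cyc_shift_neq[OF assms(1) range[OF jk(1)]]
      by (auto split: if_splits)
    moreover have "up = up'"
      using fun_cong[OF eq, of j] cyc_shift_inj[OF assms(1) range[OF jk(1)]] \<open>j = k\<close> by simp
    ultimately show "j = k \<and> up = up'" ..
  qed
  then show ?thesis
    by (simp add: torus_neighbours_eq[OF assms] card_image card_cartesian_product)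
qed

section \<open>The lower bound on the torus\<close>

lemma min_rev_dynamo_torus_ge:
  assumes "3 \<le> n" "0 < r" "r \<le> 2 * d"
  shows "real (min_rev_dynamo (torus_verts d n) (torus_adj d n) r)
           \<ge> 2 * (1 - real d / real r) * real n ^ d"
proof -
  let ?V = "torus_verts d n" and ?E = "torus_adj d n"
  have "rev_dynamo ?V ?E r ?V"
    using assms by (intro rev_dynamo_all_active) (simp add: torus_degree)
  then obtain A where A: "rev_dynamo ?V ?E r A" and m: "min_rev_dynamo ?V ?E r = card A"
    by (rule min_rev_dynamo_attained)
  have "finite ?V" and V: "card ?V = n ^ d"
    by (simp_all add: torus_verts_def finite_PiE card_PiE)
  then have "(2 * int r - int (2 * d)) * int (card ?V) \<le> int r * int (card A)"
    using A by (intro rev_dynamo_card_ge) (auto simp: torus_degree[OF assms(1)] torus_adj_sym)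
  then have "real_of_int ((2 * int r - int (2 * d)) * int (card ?V)) \<le> real_of_int (int r * int (card A))"
    by (simp only: of_int_le_iff)
  then have "2 * (real r - real d) * real n ^ d \<le> real r * real (card A)"
    by (simp add: V algebra_simps)
  then show ?thesis
    using assms(2) by (simp add: m field_simps)
qed

theorem theorem2:
  fixes d r :: nat
  assumes "1 \<le> d" and "d + 1 \<le> r" and "r \<le> 2 * d"
  shows "\<exists>(C::real) (n0::nat). C > 0 \<and>
    (\<forall>n\<ge>n0. real (min_rev_dynamo (torus_verts d n) (torus_adj d n) r)
        \<ge> 2 * (1 - real d / real r) * real n ^ d - C * real n ^ (d - 1))"
\<comment> \<open>From n = 3 on the torus is 2d-regular and the bound holds with no error term, so
  any positive C serves.\<close>
proof (rule exI[of _ 1], rule exI[of _ 3], intro conjI allI impI)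
  fix n :: nat assume "3 \<le> n"
  then have "2 * (1 - real d / real r) * real n ^ d
      \<le> real (min_rev_dynamo (torus_verts d n) (torus_adj d n) r)"
    using assms by (intro min_rev_dynamo_torus_ge) auto
  moreover have "0 \<le> real n ^ (d - 1)"
    by simp
  ultimately show "2 * (1 - real d / real r) * real n ^ d - 1 * real n ^ (d - 1)
      \<le> real (min_rev_dynamo (torus_verts d n) (torus_adj d n) r)"
    by linarith
qed simp

end
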